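(* Let $q \in \mathbb{N}$ be a prime power, let $n,d \in \mathbb{N}$ with $2 \le d \le n$, and let $G = \mathcal{G}_{q,n,d}$ be the generalized-Hamming graph. Then the following statements are equivalent: (1) $G$ is edge-transitive. (2) $G$ is distance-transitive. (3) Either $d = 2$, or $(q,d) = (2,3)$, or $(q,d) = (2,n)$.
   Context: For a prime power $q$ and $n,d\in\mathbb{N}$ with $2\le d\le n$, the generalized-Hamming graph $\mathcal{G}_{q,n,d}$ is the simple undirected graph with vertex set $\mathbb{F}_q^n$ in which two distinct vertices are adjacent if and only if their Hamming distance (the number of coordinates in which they differ) is less than $d$. A graph $G$ is edge-transitive if for every pair of edges $\{u_1,v_1\},\{u_2,v_2\}$ there is an automorphism of $G$ mapping the set $\{u_1,v_1\}$ to the set $\{u_2,v_2\}$. A graph $G$ is distance-transitive if for all vertices $u_1,u_2,v_1,v_2$ with $d_G(v_1,v_2)=d_G(u_1,u_2)$ (where $d_G$ is the graph distance) there is an automorphism of $G$ mapping $v_1$ to $u_1$ and $v_2$ to $u_2$. *)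

theory Defs
  imports "HOL-Analysis.Finite_Cartesian_Product" "HOL-Library.Extended_Nat"
begin

record 'v ugraph =
  verts :: "'v set"
  edges :: "'v set set"

definition simple_graph :: "'v ugraph \<Rightarrow> bool" where
  "simple_graph G \<longleftrightarrow> (\<forall>e\<in>edges G. e \<subseteq> verts G \<and> card e = 2)"

definition adjacent :: "'v ugraph \<Rightarrow> 'v \<Rightarrow> 'v \<Rightarrow> bool" where
  "adjacent G u v \<longleftrightarrow> {u, v} \<in> edges G"

definition automorphism :: "'v ugraph \<Rightarrow> ('v \<Rightarrow> 'v) \<Rightarrow> bool" where
  "automorphism G f \<longleftrightarrow> bij_betw f (verts G) (verts G) \<and>
     (\<forall>u\<in>verts G. \<forall>v\<in>verts G. adjacent G u v \<longleftrightarrow> adjacent G (f u) (f v))"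

text \<open>A walk is a nonempty list of vertices; its length is the number of edges traversed.\<close>

definition walk :: "'v ugraph \<Rightarrow> 'v \<Rightarrow> 'v list \<Rightarrow> 'v \<Rightarrow> bool" where
  "walk G u p v \<longleftrightarrow> p \<noteq> [] \<and> set p \<subseteq> verts G \<and> successively (adjacent G) p \<and>
     hd p = u \<and> last p = v"

text \<open>The distance is \<open>\<infinity>\<close> between vertices in different components.\<close>

definition graph_dist :: "'v ugraph \<Rightarrow> 'v \<Rightarrow> 'v \<Rightarrow> enat" where
  "graph_dist G u v = (INF p\<in>{p. walk G u p v}. enat (length p - 1))"

definition edge_transitive :: "'v ugraph \<Rightarrow> bool" where
  "edge_transitive G \<longleftrightarrow>
     (\<forall>e\<^sub>1\<in>edges G. \<forall>e\<^sub>2\<in>edges G. \<exists>f. automorphism G f \<and> f ` e\<^sub>1 = e\<^sub>2)"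

definition distance_transitive :: "'v ugraph \<Rightarrow> bool" where
  "distance_transitive G \<longleftrightarrow>
     (\<forall>u\<^sub>1\<in>verts G. \<forall>u\<^sub>2\<in>verts G. \<forall>v\<^sub>1\<in>verts G. \<forall>v\<^sub>2\<in>verts G.
        graph_dist G v\<^sub>1 v\<^sub>2 = graph_dist G u\<^sub>1 u\<^sub>2 \<longrightarrow>
        (\<exists>f. automorphism G f \<and> f v\<^sub>1 = u\<^sub>1 \<and> f v\<^sub>2 = u\<^sub>2))"

definition hamming_dist :: "'a ^ 'n \<Rightarrow> 'a ^ 'n \<Rightarrow> nat" where
  "hamming_dist x y = card {i. x $ i \<noteq> y $ i}"

text \<open>The parameters \<open>q\<close> and \<open>n\<close> are carried by the types: \<open>q = CARD('a)\<close> for a finite field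
  \<open>'a\<close> (so \<open>q\<close> ranges over the prime powers) and \<open>n = CARD('n)\<close>.\<close>

definition gen_hamming_graph :: "nat \<Rightarrow> ('a::{field,finite} ^ 'n) ugraph" where
  "gen_hamming_graph d =
     \<lparr>verts = UNIV, edges = {{x, y} |x y. x \<noteq> y \<and> hamming_dist x y < d}\<rparr>"

lemma simple_gen_hamming_graph: "simple_graph (gen_hamming_graph d)"
  by (auto simp: simple_graph_def gen_hamming_graph_def)

lemma adjacent_gen_hamming_graph:
  "adjacent (gen_hamming_graph d) x y \<longleftrightarrow> x \<noteq> y \<and> hamming_dist x y < d"
  by (auto simp: adjacent_def gen_hamming_graph_def hamming_dist_def doubleton_eq_iff eq_commute)

end

theory Submission imports Defs begin

text \<open>
  The graph distance is \<open>\<lceil>h / (d - 1)\<rceil>\<close>, where \<open>h\<close> is the Hamming distance, so adjacent pairs are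
  those at graph distance \<open>1\<close>, and distance-transitivity implies edge-transitivity. For
  distance-transitivity, Hamming isometries act transitively on pairs at a given Hamming distance.
  This suffices for \<open>d = 2\<close>. For \<open>(q, d) = (2, 3)\<close>, replacing one coordinate by the sum of all
  coordinates preserves \<open>\<lceil>h / 2\<rceil>\<close> and exchanges the Hamming distances \<open>2 k - 1\<close> and \<open>2 k\<close>. For
  \<open>(q, d) = (2, n)\<close>, non-adjacent distinct vertices are antipodal, so the antipodal pairs can be
  permuted freely.

  Conversely, in an edge-transitive graph all edges lie in equally many triangles. A vertex \<open>z\<close> lies
  in the closed neighbourhoods of both ends of the edge \<open>{0, y}\<close> iff its Hamming distances to \<open>0\<close>
  and \<open>y\<close> are less than \<open>d\<close>. If \<open>d \<ge> 3\<close> and \<open>q \<ge> 3\<close> there are more such \<open>z\<close> for \<open>y\<close> of weight 1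
  than for \<open>y\<close> of weight 2; if \<open>q = 2\<close> and \<open>3 < d < n\<close> there are more for weight 1 than for weight 3.
\<close>

section \<open>Hamming distance\<close>

lemma hamming_dist_sum:
  "hamming_dist x y = (\<Sum>i\<in>UNIV. of_bool (x $ i \<noteq> y $ i))"
  by (simp add: hamming_dist_def sum_of_bool_eq)

text \<open>Isolates a small set \<open>I\<close> of coordinates, so that their contribution becomes
  an explicit sum of 0/1 terms.\<close>

lemma hamming_dist_split:
  "hamming_dist x y = card {i. i \<notin> I \<and> x $ i \<noteq> y $ i} + (\<Sum>i\<in>I. of_bool (x $ i \<noteq> y $ i))"
proof -
  have "hamming_dist x y =
      (\<Sum>i\<in>-I. of_bool (x $ i \<noteq> y $ i)) + (\<Sum>i\<in>I. of_bool (x $ i \<noteq> y $ i))"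
    unfolding hamming_dist_sum
    by (subst sum.subset_diff[of I UNIV]) (auto simp: Compl_eq_Diff_UNIV)
  moreover have "-I \<inter> {i. x $ i \<noteq> y $ i} = {i. i \<notin> I \<and> x $ i \<noteq> y $ i}"
    by auto
  ultimately show ?thesis
    by (simp add: sum_of_bool_eq)
qed

lemma hamming_dist_eq_0_iff [simp]: "hamming_dist x y = 0 \<longleftrightarrow> x = y"
  by (simp add: hamming_dist_def vec_eq_iff)

lemma hamming_dist_le: "hamming_dist (x :: 'a ^ 'n) y \<le> CARD('n)"
  unfolding hamming_dist_def by (rule card_mono) auto

lemma hamming_dist_triangle: "hamming_dist x z \<le> hamming_dist x y + hamming_dist y z"
proof -
  have "hamming_dist x z \<le> card ({i. x $ i \<noteq> y $ i} \<union> {i. y $ i \<noteq> z $ i})"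
    unfolding hamming_dist_def by (rule card_mono) auto
  also have "\<dots> \<le> hamming_dist x y + hamming_dist y z"
    unfolding hamming_dist_def by (rule card_Un_le)
  finally show ?thesis .
qed

lemma hamming_dist_translate [simp]:
  fixes x y z :: "'a::group_add ^ 'n"
  shows "hamming_dist (x + z) (y + z) = hamming_dist x y"
  by (simp add: hamming_dist_def)

section \<open>Graph distance\<close>

lemma verts_gen_hamming_graph [simp]: "verts (gen_hamming_graph d) = UNIV"
  by (simp add: gen_hamming_graph_def)

text \<open>Each edge of the walk changes at most \<open>d - 1\<close> coordinates, and the changes
  add up by the triangle inequality.\<close>

lemma walk_hamming_dist_le:
  assumes "walk (gen_hamming_graph d) u p v"
  shows "hamming_dist u v \<le> (length p - 1) * (d - 1)"
  using assms
proof (induction p arbitrary: u)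
  case Nil
  then show ?case by (simp add: walk_def)
next
  case (Cons a p)
  show ?case
  proof (cases p)
    case Nil
    with Cons.prems show ?thesis by (auto simp: walk_def)
  next
    case (Cons b p')
    with Cons.prems have adj: "hamming_dist u b < d" and "walk (gen_hamming_graph d) b p v"
      by (auto simp: walk_def adjacent_gen_hamming_graph)
    with Cons.IH have "hamming_dist b v \<le> (length p - 1) * (d - 1)"
      by blast
    moreover have "hamming_dist u b \<le> d - 1"
      using adj by simp
    ultimately show ?thesis
      using hamming_dist_triangle[of u v b] Cons by simp
  qed
qed

text \<open>Greedy construction: each step corrects \<open>d - 1\<close> of the differing
  coordinates, or all of them if fewer remain. The length is only bounded, since a step may have
  nothing left to correct and is then dropped.\<close>

lemma ex_walk_hamming_dist:
  assumes "2 \<le> d" "hamming_dist u v \<le> m * (d - 1)"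
  shows "\<exists>p. walk (gen_hamming_graph d) u p v \<and> length p - 1 \<le> m"
  using assms(2)
proof (induction m arbitrary: u)
  case 0
  then have "walk (gen_hamming_graph d) u [u] v"
    by (simp add: walk_def)
  then show ?case by (metis length_Cons list.size(3) diff_Suc_1 order_refl One_nat_def)
next
  case (Suc m)
  let ?D = "{i. u $ i \<noteq> v $ i}"
  obtain A where A: "A \<subseteq> ?D" "card A = min (d - 1) (card ?D)"
    using obtain_subset_with_card_n[of "min (d - 1) (card ?D)" ?D] by auto
  define w where "w = (\<chi> i. if i \<in> A then v $ i else u $ i)"
  have "{i. u $ i \<noteq> w $ i} = A" "{i. w $ i \<noteq> v $ i} = ?D - A"
    using A(1) by (auto simp: w_def)
  then have uw: "hamming_dist u w < d" and wv: "hamming_dist w v = hamming_dist u v - card A"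
    using A assms(1) by (auto simp: hamming_dist_def card_Diff_subset)
  have "hamming_dist w v \<le> m * (d - 1)"
    using Suc.prems A(2) wv by (auto simp: hamming_dist_def min_def split: if_splits)
  from Suc.IH[OF this] obtain p
    where p: "walk (gen_hamming_graph d) w p v" "length p - 1 \<le> m" by blast
  show ?case
  proof (cases "u = w")
    case True
    with p show ?thesis by auto
  next
    case False
    have "walk (gen_hamming_graph d) u (u # p) v"
      using p uw False by (cases p) (auto simp: walk_def adjacent_gen_hamming_graph)
    moreover have "length (u # p) - 1 \<le> Suc m"
      using p(2) by simp
    ultimately show ?thesis by blast
  qed
qed

text \<open>The quotient is the ceiling of h / (d - 1), expressed by division of natural
  numbers.\<close>

lemma graph_dist_gen_hamming_graph:
  assumes "2 \<le> d"
  shows "graph_dist (gen_hamming_graph d) u v = enat ((hamming_dist u v + (d - 2)) div (d - 1))"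
proof (rule antisym)
  let ?m = "(hamming_dist u v + (d - 2)) div (d - 1)"
  \<comment> \<open>Writing \<open>d\<close> as \<open>e + 2\<close> removes the truncated
    subtractions.\<close>
  obtain e where d: "d = Suc (Suc e)"
    using assms by (metis One_nat_def add_2_eq_Suc le_Suc_ex)
  then have e: "d - 1 = Suc e" "d - 2 = e"
    by simp_all
  have "hamming_dist u v + e = ?m * Suc e + (hamming_dist u v + e) mod Suc e"
    unfolding e by (simp only: div_mult_mod_eq)
  moreover have "(hamming_dist u v + e) mod Suc e \<le> e"
    using mod_less_divisor[of "Suc e" "hamming_dist u v + e"] by linarith
  ultimately have "hamming_dist u v \<le> ?m * (d - 1)"
    unfolding e by linarith
  from ex_walk_hamming_dist[OF assms this] obtain p
    where "walk (gen_hamming_graph d) u p v" "length p - 1 \<le> ?m" by blast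
  then show "graph_dist (gen_hamming_graph d) u v \<le> enat ?m"
    unfolding graph_dist_def by (intro INF_lower2[of p]) auto
  show "enat ?m \<le> graph_dist (gen_hamming_graph d) u v"
    unfolding graph_dist_def
  proof (rule INF_greatest)
    fix p assume "p \<in> {p. walk (gen_hamming_graph d) u p v}"
    then have "hamming_dist u v \<le> (length p - 1) * Suc e"
      using walk_hamming_dist_le[of d u p v] d by simp
    then have "?m \<le> ((length p - 1) * Suc e + e) div Suc e"
      unfolding e by (intro div_le_mono) simp
    also have "\<dots> = length p - 1"
      by (subst div_mult_self3) auto
    finally show "enat ?m \<le> enat (length p - 1)" by simp
  qed
qed

lemma graph_dist_eq_1:
  assumes "2 \<le> d" "x \<noteq> y" "hamming_dist x y < d"
  shows "graph_dist (gen_hamming_graph d) x y = 1"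
proof -
  have "0 < hamming_dist x y"
    using assms(2) by (metis hamming_dist_eq_0_iff neq0_conv)
  then have "(hamming_dist x y + (d - 2)) div (d - 1) = 1"
    using assms by (intro div_nat_eqI) auto
  then show ?thesis
    by (simp add: graph_dist_gen_hamming_graph[OF assms(1)] one_enat_def)
qed

section \<open>Automorphisms\<close>

lemma automorphism_gen_hamming_graph:
  fixes f :: "'a::{field,finite} ^ 'n \<Rightarrow> 'a ^ 'n"
  assumes "0 < d"
  shows "automorphism (gen_hamming_graph d) f \<longleftrightarrow>
    bij f \<and> (\<forall>x y. hamming_dist (f x) (f y) < d \<longleftrightarrow> hamming_dist x y < d)"
    (is "?l \<longleftrightarrow> bij f \<and> ?r")
proof -
  have "(\<forall>x y. adjacent (gen_hamming_graph d) x y \<longleftrightarrow> adjacent (gen_hamming_graph d) (f x) (f y))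
      \<longleftrightarrow> ?r" if "bij f"
    using bij_is_inj[OF that] assms
    by (metis adjacent_gen_hamming_graph hamming_dist_eq_0_iff inj_eq)
  then show ?thesis
    by (auto simp: automorphism_def)
qed

lemma ex_bij_image_eq:
  fixes A B :: "'n::finite set"
  assumes "card A = card B"
  obtains \<sigma> where "bij \<sigma>" "\<And>i. \<sigma> i \<in> B \<longleftrightarrow> i \<in> A"
proof -
  obtain f where f: "bij_betw f A B"
    using assms finite_same_card_bij[of A B] by auto
  obtain g where g: "bij_betw g (-A) (-B)"
    using assms finite_same_card_bij[of "-A" "-B"] by (auto simp: Compl_eq_Diff_UNIV card_Diff_subset)
  define \<sigma> where "\<sigma> i = (if i \<in> A then f i else g i)" for i
  have "bij_betw \<sigma> A B" "bij_betw \<sigma> (-A) (-B)"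
    using f g bij_betw_cong[of A \<sigma> f] bij_betw_cong[of "-A" \<sigma> g] by (simp_all add: \<sigma>_def)
  then have "bij_betw \<sigma> (A \<union> -A) (B \<union> -B)"
    by (intro bij_betw_combine) auto
  moreover have "\<sigma> i \<in> B \<longleftrightarrow> i \<in> A" for i
    using f g by (auto simp: \<sigma>_def bij_betw_def)
  ultimately show ?thesis
    using that by simp
qed

text \<open>A coordinate permutation matches the positions where the two pairs differ; then an
  invertible affine map in each coordinate adjusts the values.\<close>

lemma ex_isometry:
  fixes v1 v2 u1 u2 :: "'a::{field,finite} ^ 'n"
  assumes "hamming_dist v1 v2 = hamming_dist u1 u2"
  obtains f :: "'a ^ 'n \<Rightarrow> 'a ^ 'n" where "bij f"
    "\<And>x y. hamming_dist (f x) (f y) = hamming_dist x y" "f v1 = u1" "f v2 = u2"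
proof -
  obtain \<sigma> where \<sigma>: "bij \<sigma>"
    "\<And>i. \<sigma> i \<in> {i. v1 $ i \<noteq> v2 $ i} \<longleftrightarrow> i \<in> {i. u1 $ i \<noteq> u2 $ i}"
    using ex_bij_image_eq[of "{i. u1 $ i \<noteq> u2 $ i}" "{i. v1 $ i \<noteq> v2 $ i}"] assms
    unfolding hamming_dist_def by metis
  \<comment> \<open>The slope of the line through the two prescribed value pairs. Where
    \<open>u1\<close> and \<open>u2\<close> agree, \<open>v1\<close> and \<open>v2\<close> agree at
    \<open>\<sigma> i\<close>, and any nonzero slope would do.\<close>
  define k where "k i = (if u1 $ i = u2 $ i then 1
    else (u2 $ i - u1 $ i) / (v2 $ \<sigma> i - v1 $ \<sigma> i))" for i
  have k: "k i \<noteq> 0" for i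
    using \<sigma>(2)[of i] by (auto simp: k_def)
  define f :: "'a ^ 'n \<Rightarrow> 'a ^ 'n"
    where "f x = (\<chi> i. u1 $ i + (x $ \<sigma> i - v1 $ \<sigma> i) * k i)" for x
  have iso: "hamming_dist (f x) (f y) = hamming_dist x y" for x y
  proof -
    have "{i. f x $ i \<noteq> f y $ i} = \<sigma> -` {i. x $ i \<noteq> y $ i}"
      using k by (auto simp: f_def)
    then show ?thesis
      using \<sigma>(1) card_vimage_inj[of \<sigma> "{i. x $ i \<noteq> y $ i}"]
      unfolding hamming_dist_def bij_def by simp
  qed
  have "inj f"
    by (rule injI) (metis iso hamming_dist_eq_0_iff)
  then have "bij f"
    by (simp add: bij_def finite_UNIV_inj_surj)
  moreover have "f v1 = u1" by (simp add: f_def)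
  moreover have "f v2 = u2"
    unfolding vec_eq_iff
  proof
    fix i show "f v2 $ i = u2 $ i"
      using \<sigma>(2)[of i] by (auto simp: f_def k_def)
  qed
  ultimately show ?thesis using that iso by blast
qed

lemma distance_transitive_if_distance_2:
  "distance_transitive (gen_hamming_graph 2 :: ('a::{field,finite} ^ 'n) ugraph)"
  unfolding distance_transitive_def
proof (intro ballI impI)
  fix u1 u2 v1 v2 :: "'a ^ 'n"
  assume "graph_dist (gen_hamming_graph 2) v1 v2 = graph_dist (gen_hamming_graph 2) u1 u2"
  then have "hamming_dist v1 v2 = hamming_dist u1 u2"
    by (simp add: graph_dist_gen_hamming_graph)
  then obtain f where "bij f" "\<And>x y. hamming_dist (f x) (f y) = hamming_dist x y"
      "f v1 = u1" "f v2 = u2"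
    using ex_isometry by blast
  then show "\<exists>f. automorphism (gen_hamming_graph 2) f \<and> f v1 = u1 \<and> f v2 = u2"
    by (auto simp: automorphism_gen_hamming_graph)
qed

section \<open>The binary field\<close>

lemma two_element_field:
  assumes "CARD('a::{field,finite}) = 2"
  shows "(x :: 'a) = 0 \<or> x = 1"
proof -
  have "{0, 1} = (UNIV :: 'a set)"
    by (rule card_subset_eq) (use assms in auto)
  then show ?thesis by blast
qed

lemma two_element_field_add_self:
  assumes "CARD('a::{field,finite}) = 2"
  shows "(x :: 'a) + x = 0"
proof -
  have "(1 :: 'a) + 1 = 0"
    using two_element_field[OF assms, of "1 + 1"] by (metis add_cancel_right_right zero_neq_one)
  then show ?thesis
    using two_element_field[OF assms, of x] by auto
qed

lemma two_element_field_neq_iff: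
  assumes "CARD('a::{field,finite}) = 2"
  shows "(x :: 'a) \<noteq> y \<longleftrightarrow> y = x + 1"
  using two_element_field[OF assms, of x] two_element_field[OF assms, of y]
    two_element_field_add_self[OF assms, of 1] by auto

text \<open>The difference of the sums is the Hamming distance reduced modulo 2, because every
  differing coordinate contributes 1.\<close>

lemma two_element_field_sum_diff:
  fixes x y :: "'a::{field,finite} ^ 'n"
  assumes "CARD('a) = 2"
  shows "(\<Sum>i\<in>UNIV. x $ i) = (\<Sum>i\<in>UNIV. y $ i) \<longleftrightarrow> even (hamming_dist x y)"
proof -
  have "(\<Sum>i\<in>UNIV. x $ i) - (\<Sum>i\<in>UNIV. y $ i) = (\<Sum>i\<in>UNIV. x $ i - y $ i)"
    by (simp add: sum_subtractf)
  also have "\<dots> = (\<Sum>i\<in>UNIV. of_bool (x $ i \<noteq> y $ i))"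
  proof (rule sum.cong)
    fix i show "x $ i - y $ i = of_bool (x $ i \<noteq> y $ i)"
      using two_element_field[OF assms, of "x $ i - y $ i"] by auto
  qed simp
  also have "\<dots> = of_nat (hamming_dist x y)"
    by (simp add: hamming_dist_def sum_of_bool_eq)
  finally have *: "(\<Sum>i\<in>UNIV. x $ i) - (\<Sum>i\<in>UNIV. y $ i) = of_nat (hamming_dist x y)" .
  have "(of_nat k :: 'a) = of_bool (odd k)" for k
  proof (induction k)
    case (Suc k)
    then show ?case
      using two_element_field_add_self[OF assms, of 1] by (cases "odd k") simp_all
  qed simp
  then show ?thesis using * by (metis right_minus_eq of_bool_eq_0_iff)
qed

text \<open>Two images differ at \<open>j\<close> exactly when the original distance is odd, so a
  distance either stays or moves to the other member of its pair {2k - 1, 2k}. The last clause shows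
  that whether it moves depends on \<open>j\<close>, which the user of the lemma may choose.\<close>

lemma ex_half_isometry:
  fixes j :: "'n::finite"
  assumes "CARD('a::{field,finite}) = 2"
  obtains f :: "('a::{field,finite}) ^ 'n \<Rightarrow> 'a ^ 'n" where "bij f"
    "\<And>x y. (hamming_dist (f x) (f y) + 1) div 2 = (hamming_dist x y + 1) div 2"
    "\<And>x y. hamming_dist (f x) (f y) =
      card {i. i \<notin> {j} \<and> x $ i \<noteq> y $ i} + of_bool (odd (hamming_dist x y))"
proof -
  define f :: "'a ^ 'n \<Rightarrow> 'a ^ 'n"
    where "f x = (\<chi> i. if i = j then \<Sum>l\<in>UNIV. x $ l else x $ i)" for x
  have f: "hamming_dist (f x) (f y) =
      card {i. i \<notin> {j} \<and> x $ i \<noteq> y $ i} + of_bool (odd (hamming_dist x y))" for x y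
  proof -
    have "{i. i \<notin> {j} \<and> f x $ i \<noteq> f y $ i} = {i. i \<notin> {j} \<and> x $ i \<noteq> y $ i}"
      by (auto simp: f_def)
    moreover have "f x $ j \<noteq> f y $ j \<longleftrightarrow> odd (hamming_dist x y)"
      by (simp add: f_def two_element_field_sum_diff[OF assms])
    ultimately show ?thesis
      using hamming_dist_split[of "f x" "f y" "{j}"] by simp
  qed
  have half: "(hamming_dist (f x) (f y) + 1) div 2 = (hamming_dist x y + 1) div 2" for x y
  proof -
    have "(h' + 1) div 2 = (h + 1) div 2"
      if "h' = c + (if odd h then 1 else 0)" "h = c \<or> h = c + 1" for h h' c :: nat
      using that by (cases "odd h") (simp_all, presburger+)
    then show ?thesis
      using f[of x y] hamming_dist_split[of x y "{j}"] by (simp add: of_bool_def)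
  qed
  have "inj f"
  proof (rule injI)
    fix x y assume "f x = f y"
    then have "(hamming_dist x y + 1) div 2 = 0"
      using half[of x y] hamming_dist_eq_0_iff[of "f x" "f y"] by simp
    then have "hamming_dist x y = 0" by presburger
    then show "x = y" by simp
  qed
  then have "bij f"
    by (simp add: bij_def finite_UNIV_inj_surj)
  with half f that show ?thesis by blast
qed

section \<open>Distance-transitivity in the two binary cases\<close>

lemma distance_transitive_if_binary_distance_3:
  assumes q: "CARD('a::{field,finite}) = 2"
  shows "distance_transitive (gen_hamming_graph 3 :: ('a ^ 'n) ugraph)"
  unfolding distance_transitive_def
proof (intro ballI impI)
  fix u1 u2 v1 v2 :: "'a ^ 'n"
  let ?h = "hamming_dist v1 v2" and ?k = "hamming_dist u1 u2"
  assume "graph_dist (gen_hamming_graph 3) v1 v2 = graph_dist (gen_hamming_graph 3) u1 u2"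
  then have eq: "(?h + 1) div 2 = (?k + 1) div 2"
    by (simp add: graph_dist_gen_hamming_graph)
  \<comment> \<open>First \<open>g\<close> corrects the Hamming distance to \<open>?k\<close>; an
    isometry can then do the rest.\<close>
  have "\<exists>g :: 'a ^ 'n \<Rightarrow> 'a ^ 'n. bij g \<and>
    (\<forall>x y. (hamming_dist (g x) (g y) + 1) div 2 = (hamming_dist x y + 1) div 2) \<and>
    hamming_dist (g v1) (g v2) = ?k"
  proof (cases "?h = ?k")
    case True
    then show ?thesis by (intro exI[of _ id]) auto
  next
    case False
    \<comment> \<open>To lower the distance, \<open>j\<close> must be a differing coordinate; to
      raise it, an agreeing one, which exists because \<open>?h < ?k\<close> and \<open>?k\<close>
      is at most the number of coordinates.\<close>
    have "\<exists>j. (v1 $ j \<noteq> v2 $ j) \<longleftrightarrow> ?k < ?h"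
    proof (cases "?k < ?h")
      case True
      then have "v1 \<noteq> v2" by (metis hamming_dist_eq_0_iff not_less0)
      then show ?thesis using True by (auto simp: vec_eq_iff)
    next
      case False
      with \<open>?h \<noteq> ?k\<close> have "?h < CARD('n)"
        using hamming_dist_le[of u1 u2] by simp
      then have "{i. v1 $ i \<noteq> v2 $ i} \<noteq> UNIV"
        by (auto simp: hamming_dist_def)
      then show ?thesis using False by auto
    qed
    then obtain j where j: "(v1 $ j \<noteq> v2 $ j) \<longleftrightarrow> ?k < ?h" by blast
    obtain g :: "'a ^ 'n \<Rightarrow> 'a ^ 'n" where g: "bij g"
        "\<And>x y. (hamming_dist (g x) (g y) + 1) div 2 = (hamming_dist x y + 1) div 2"
        "\<And>x y. hamming_dist (g x) (g y) =
          card {i. i \<notin> {j} \<and> x $ i \<noteq> y $ i} + of_bool (odd (hamming_dist x y))"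
      using ex_half_isometry[OF q] by blast
    define c where "c = card {i. i \<notin> {j} \<and> v1 $ i \<noteq> v2 $ i}"
    have "?h = (if ?k < ?h then c + 1 else c)"
      using hamming_dist_split[of v1 v2 "{j}"] j by (auto simp: c_def)
    moreover have "k = (if odd h then c + 1 else c)"
      if "(h + 1) div 2 = (k + 1) div 2" "h \<noteq> k" "h = (if k < h then c + 1 else c)"
      for h k c :: nat
    proof (cases "odd h")
      case True
      then have "k = h + 1" using that(1,2) by presburger
      with True that(3) show ?thesis by simp
    next
      case False
      then have "h = k + 1" using that(1,2) by presburger
      with False that(3) show ?thesis by simp
    qed
    ultimately have "?k = (if odd ?h then c + 1 else c)"
      using eq False by blast
    then have "hamming_dist (g v1) (g v2) = ?k"
      using g(3)[of v1 v2] by (simp add: c_def)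
    with g(1,2) show ?thesis by blast
  qed
  then obtain g :: "'a ^ 'n \<Rightarrow> 'a ^ 'n" where g: "bij g"
    "\<And>x y. (hamming_dist (g x) (g y) + 1) div 2 = (hamming_dist x y + 1) div 2"
    "hamming_dist (g v1) (g v2) = ?k" by blast
  obtain f where f: "bij f" "\<And>x y. hamming_dist (f x) (f y) = hamming_dist x y"
      "f (g v1) = u1" "f (g v2) = u2"
    using ex_isometry[OF g(3)] by blast
  \<comment> \<open>Adjacency for \<open>d = 3\<close> thus depends only on the quantity that
    \<open>g\<close> preserves.\<close>
  have "h < 3 \<longleftrightarrow> (h + 1) div 2 < 2" for h :: nat by presburger
  then have "automorphism (gen_hamming_graph 3) (f \<circ> g)"
    using f(1,2) g(1,2) by (auto simp: automorphism_gen_hamming_graph bij_comp)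
  with f(3,4) show "\<exists>f. automorphism (gen_hamming_graph 3) f \<and> f v1 = u1 \<and> f v2 = u2"
    by (intro exI[of _ "f \<circ> g"]) auto
qed

lemma distance_transitive_if_binary_distance_card:
  assumes q: "CARD('a::{field,finite}) = 2" and n: "2 \<le> CARD('n)"
  shows "distance_transitive (gen_hamming_graph CARD('n) :: ('a ^ 'n) ugraph)"
  unfolding distance_transitive_def
proof (intro ballI impI)
  let ?G = "gen_hamming_graph CARD('n) :: ('a ^ 'n) ugraph"
  fix u1 u2 v1 v2 :: "'a ^ 'n"
  assume eq: "graph_dist ?G v1 v2 = graph_dist ?G u1 u2"
  \<comment> \<open>Adding the all-ones vector takes a vertex to its antipode.\<close>
  define e :: "'a ^ 'n" where "e = (\<chi> i. 1)"
  have self: "x + x = 0" for x :: "'a ^ 'n"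
    using two_element_field_add_self[OF q]
    by (intro vec_eq_iff[THEN iffD2] allI) (simp only: vector_add_component zero_index)
  then have self': "x + (x + y) = y" for x y :: "'a ^ 'n"
    by (metis add.assoc add_0)
  have antipodal: "hamming_dist x y < CARD('n) \<longleftrightarrow> y \<noteq> x + e" for x y :: "'a ^ 'n"
  proof -
    have "hamming_dist x y = CARD('n) \<longleftrightarrow> {i. x $ i \<noteq> y $ i} = UNIV"
      unfolding hamming_dist_def by (metis card_eq_UNIV_imp_eq_UNIV finite_class.finite_UNIV)
    also have "\<dots> \<longleftrightarrow> (\<forall>i. x $ i \<noteq> y $ i)" by blast
    also have "\<dots> \<longleftrightarrow> y = x + e"
      by (simp add: two_element_field_neq_iff[OF q] vec_eq_iff e_def)
    finally show ?thesis using hamming_dist_le[of x y] by linarith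
  qed
  show "\<exists>f. automorphism ?G f \<and> f v1 = u1 \<and> f v2 = u2"
  proof (cases "hamming_dist v1 v2 = hamming_dist u1 u2")
    case True
    then obtain f where "bij f" "\<And>x y. hamming_dist (f x) (f y) = hamming_dist x y"
        "f v1 = u1" "f v2 = u2"
      using ex_isometry by blast
    then show ?thesis
      by (auto simp: automorphism_gen_hamming_graph)
  next
    case False
    let ?c = "\<lambda>h. (h + (CARD('n) - 2)) div (CARD('n) - 1)"
    have eq': "?c (hamming_dist v1 v2) = ?c (hamming_dist u1 u2)"
      using eq by (simp add: graph_dist_gen_hamming_graph[OF n])
    have c: "?c h = (if h = 0 then 0 else if h < CARD('n) then 1 else 2)" if "h \<le> CARD('n)" for h
    proof -
      consider "h = 0" | "h \<noteq> 0" "h < CARD('n)" | "h = CARD('n)"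
        using \<open>h \<le> CARD('n)\<close> by linarith
      then show ?thesis
      proof cases
        case 1
        then show ?thesis using n by simp
      next
        case 2
        then have "?c h = 1" by (intro div_nat_eqI) auto
        then show ?thesis using 2 by simp
      next
        case 3
        have "?c h = 2" using n 3 by (intro div_nat_eqI) auto
        then show ?thesis using 3 n by simp
      qed
    qed
    \<comment> \<open>Graph distances 0 and 2 each determine the Hamming distance, so unequal
      Hamming distances with equal graph distance must both belong to adjacent pairs.\<close>
    have "(if h = 0 then 0 else if h < N then 1 else 2) \<noteq>
        (if k = 0 then 0 else if k < N then 1 else (2 :: nat))"
      if "h \<noteq> k" "h \<le> N" "k \<le> N" "\<not> (h \<noteq> 0 \<and> h < N \<and> k \<noteq> 0 \<and> k < N)" for h k N :: nat
      using that by auto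
    then have hk: "hamming_dist v1 v2 \<noteq> 0" "hamming_dist v1 v2 < CARD('n)"
      "hamming_dist u1 u2 \<noteq> 0" "hamming_dist u1 u2 < CARD('n)"
      using False eq'[unfolded c[OF hamming_dist_le]] hamming_dist_le[of v1 v2]
        hamming_dist_le[of u1 u2] by blast+
    \<comment> \<open>The translation taking \<open>v1\<close> to \<open>u1\<close> takes
      \<open>v2\<close> to \<open>a\<close>; it remains to move \<open>a\<close> to
      \<open>u2\<close> while fixing \<open>u1\<close>.\<close>
    define a where "a = v2 + (u1 - v1)"
    let ?X = "{a, u2, a + e, u2 + e}"
    \<comment> \<open>In characteristic 2, adding \<open>a + u2\<close> exchanges \<open>a\<close>
      with \<open>u2\<close> and \<open>a + e\<close> with \<open>u2 + e\<close>. Applied to these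
      antipodal pairs only, it is an involution that commutes with adding \<open>e\<close>.\<close>
    define g where "g x = (if x \<in> ?X then x + (a + u2) else x)" for x
    have "a + (a + u2) = u2" "u2 + (a + u2) = a"
      "a + e + (a + u2) = u2 + e" "u2 + e + (a + u2) = a + e"
      using self'[of a u2] self'[of u2 a] self'[of a "u2 + e"] self'[of u2 "a + e"]
      by (simp_all only: add_ac)
    then have shift: "x + (a + u2) \<in> ?X" if "x \<in> ?X" for x
      using that by (elim insertE emptyE) simp_all
    have cancel: "x + t + t = x" for x t :: "'a ^ 'n"
      by (simp only: add.assoc self add_0_right)
    have gg: "g (g x) = x" for x
    proof (cases "x \<in> ?X")
      case True
      with shift[OF True] show ?thesis unfolding g_def by (simp only: if_True cancel)
    next
      case False
      then show ?thesis unfolding g_def by (simp only: if_False)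
    qed
    then have "bij g" by (rule involuntory_imp_bij)
    have X: "x + e \<in> ?X" if "x \<in> ?X" for x
      using that by (elim insertE emptyE) (simp_all only: cancel insert_iff simp_thms)
    have "x + e \<in> ?X \<longleftrightarrow> x \<in> ?X" for x
      using X[of x] X[of "x + e"] unfolding cancel by blast
    then have ge: "g (x + e) = g x + e" for x
      unfolding g_def by (simp only: add.assoc add.commute[of e] split: if_split) blast
    have "u1 \<noteq> u2" "u2 \<noteq> u1 + e" using hk(3,4) antipodal[of u1 u2] by auto
    moreover have "v1 \<noteq> v2" "v2 \<noteq> v1 + e" using hk(1,2) antipodal[of v1 v2] by auto
    moreover have "u1 \<noteq> a" "u1 \<noteq> a + e"
      using \<open>v1 \<noteq> v2\<close> \<open>v2 \<noteq> v1 + e\<close> cancel[of v2 e] by (auto simp: a_def algebra_simps)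
    moreover have "u1 \<noteq> u2 + e"
      using \<open>u2 \<noteq> u1 + e\<close> cancel[of u2 e] by metis
    ultimately have "u1 \<notin> ?X"
      by simp
    then have "g u1 = u1" by (simp add: g_def)
    moreover have "g a = u2" by (simp add: g_def self')
    moreover have "automorphism ?G (\<lambda>x. g (x + (u1 - v1)))"
    proof -
      have "g y = g x + e \<longleftrightarrow> y = x + e" for x y
        by (metis gg ge)
      then have "hamming_dist (g x) (g y) < CARD('n) \<longleftrightarrow> hamming_dist x y < CARD('n)" for x y
        by (simp add: antipodal)
      moreover have "bij (\<lambda>x. g (x + (u1 - v1)))"
        using bij_comp[OF bij_plus_right[of "u1 - v1"] \<open>bij g\<close>] by (simp add: comp_def)
      ultimately show ?thesis
        using n by (simp add: automorphism_gen_hamming_graph)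
    qed
    ultimately show ?thesis
      by (intro exI[of _ "\<lambda>x. g (x + (u1 - v1))"]) (simp add: a_def)
  qed
qed

section \<open>Counting common neighbours\<close>

text \<open>An automorphism taking one edge to the other maps the common closed neighbourhood of its
  ends bijectively onto that of the other edge.\<close>

lemma edge_transitive_card_common:
  fixes y y' :: "'a::{field,finite} ^ 'n"
  assumes "edge_transitive (gen_hamming_graph d :: ('a ^ 'n) ugraph)"
    and "y \<noteq> 0" "hamming_dist 0 y < d" and "y' \<noteq> 0" "hamming_dist 0 y' < d"
  shows "card {z. hamming_dist 0 z < d \<and> hamming_dist y z < d} =
    card {z. hamming_dist 0 z < d \<and> hamming_dist y' z < d}"
proof -
  have "{0, y} \<in> edges (gen_hamming_graph d)" "{0, y'} \<in> edges (gen_hamming_graph d)"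
    using assms adjacent_gen_hamming_graph[of d 0 y] adjacent_gen_hamming_graph[of d 0 y']
    by (auto simp: adjacent_def)
  with assms(1) obtain f :: "'a ^ 'n \<Rightarrow> 'a ^ 'n"
    where f: "automorphism (gen_hamming_graph d) f" "f ` {0, y} = {0, y'}"
    unfolding edge_transitive_def by blast
  have "0 < d" using assms(3) by simp
  with f(1) have bij: "bij f"
    and iff: "hamming_dist (f x) (f z) < d \<longleftrightarrow> hamming_dist x z < d" for x z
    by (simp_all add: automorphism_gen_hamming_graph)
  \<comment> \<open>Quantifying over the set of both ends covers the case that \<open>f\<close>
    swaps them.\<close>
  have "{z. \<forall>x\<in>{0, y'}. hamming_dist x z < d} = {z. \<forall>x\<in>{0, y}. hamming_dist (f x) z < d}"
    using f(2) by (metis (no_types, lifting) image_iff)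
  also have "\<dots> = f ` {z. \<forall>x\<in>{0, y}. hamming_dist (f x) (f z) < d}"
    using bij_is_surj[OF bij] by auto
  also have "\<dots> = f ` {z. \<forall>x\<in>{0, y}. hamming_dist x z < d}"
    by (simp only: iff)
  finally show ?thesis
    using card_image[of f] inj_on_subset[OF bij_is_inj[OF bij]] by simp
qed

text \<open>The first summand does not involve \<open>x\<close>, so distances from several vectors
  supported on \<open>I\<close> can be compared by looking at the values of \<open>z\<close> on
  \<open>I\<close> alone.\<close>

lemma hamming_dist_supported:
  assumes "\<And>i. i \<notin> I \<Longrightarrow> x $ i = 0"
  shows "hamming_dist x z = card {i. i \<notin> I \<and> z $ i \<noteq> 0} + (\<Sum>i\<in>I. of_bool (x $ i \<noteq> z $ i))"
proof -
  have "{i. i \<notin> I \<and> x $ i \<noteq> z $ i} = {i. i \<notin> I \<and> z $ i \<noteq> 0}"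
    using assms by auto
  then show ?thesis using hamming_dist_split[of x z I] by simp
qed

lemma ex_vec_weight_outside:
  fixes w :: "'a::zero_neq_one ^ 'n"
  assumes "m + card I \<le> CARD('n)"
  obtains z :: "'a ^ 'n" where "card {i. i \<notin> I \<and> z $ i \<noteq> 0} = m" "\<And>i. i \<in> I \<Longrightarrow> z $ i = w $ i"
proof -
  have "m \<le> card (-I)"
    using assms by (simp add: Compl_eq_Diff_UNIV card_Diff_subset)
  then obtain A where A: "A \<subseteq> -I" "card A = m"
    using obtain_subset_with_card_n by metis
  define z :: "'a ^ 'n" where "z = (\<chi> i. if i \<in> I then w $ i else of_bool (i \<in> A))"
  have "{i. i \<notin> I \<and> z $ i \<noteq> 0} = A"
    using A(1) by (auto simp: z_def)
  with A(2) have "card {i. i \<notin> I \<and> z $ i \<noteq> 0} = m" by simp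
  moreover have "z $ i = w $ i" if "i \<in> I" for i
    using that by (simp add: z_def)
  ultimately show ?thesis using that by blast
qed

text \<open>\<open>F\<close> embeds \<open>A\<close> into \<open>B\<close> and misses
  \<open>z\<close>: a preimage of \<open>z\<close> in \<open>A\<close> would have to be
  \<open>F z\<close>.\<close>

lemma card_less_if_involution:
  fixes F :: "'a::finite \<Rightarrow> 'a"
  assumes "\<And>z. F (F z) = z" "\<And>z. z \<in> A \<Longrightarrow> F z \<in> B" "z \<in> B" "F z \<notin> A"
  shows "card A < card B"
proof -
  have "F ` A \<subset> B"
    using assms by (metis image_iff image_subsetI psubsetI)
  then have "card (F ` A) < card B" by (rule psubset_card_mono[rotated]) simp
  moreover have "inj_on F A" by (metis assms(1) inj_onI)
  ultimately show ?thesis by (simp add: card_image)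
qed

section \<open>Failure of edge-transitivity for the remaining parameters\<close>

lemma not_edge_transitive_if_card_ge_3:
  assumes q: "3 \<le> CARD('a::{field,finite})" and d: "3 \<le> d" "d \<le> CARD('n)"
  shows "\<not> edge_transitive (gen_hamming_graph d :: ('a ^ 'n) ugraph)"
proof
  assume et: "edge_transitive (gen_hamming_graph d :: ('a ^ 'n) ugraph)"
  obtain T :: "'n set" where "card T = 2"
    using obtain_subset_with_card_n[of 2 "UNIV :: 'n set"] d by auto
  then obtain i j :: 'n where ij: "i \<noteq> j" by (auto simp: card_2_iff)
  have "\<not> UNIV \<subseteq> {0, 1 :: 'a}"
    using card_mono[of "{0, 1 :: 'a}" UNIV] q by auto
  then obtain c :: 'a where c: "c \<noteq> 0" "c \<noteq> 1" by auto
  define y y' :: "'a ^ 'n" where "y = (\<chi> l. of_bool (l = i))"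
    and "y' = (\<chi> l. of_bool (l \<in> {i, j}))"
  define K where "K z = card {l. l \<notin> {i, j} \<and> z $ l \<noteq> 0}" for z :: "'a ^ 'n"
  have h0: "hamming_dist 0 z = K z + of_bool (z $ i \<noteq> 0) + of_bool (z $ j \<noteq> 0)" for z
    using hamming_dist_supported[of "{i, j}" 0 z] ij by (auto simp: K_def)
  have hy: "hamming_dist y z = K z + of_bool (z $ i \<noteq> 1) + of_bool (z $ j \<noteq> 0)" for z
    using hamming_dist_supported[of "{i, j}" y z] ij by (auto simp: K_def y_def)
  have hy': "hamming_dist y' z = K z + of_bool (z $ i \<noteq> 1) + of_bool (z $ j \<noteq> 1)" for z
    using hamming_dist_supported[of "{i, j}" y' z] ij by (auto simp: K_def y'_def)
  have y: "y $ i = 1" "y $ j = 0" "y' $ i = 1" "y' $ j = 1" "K y = 0" "K y' = 0"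
    using ij by (auto simp: y_def y'_def K_def)
  let ?S = "\<lambda>y. {z. hamming_dist 0 z < d \<and> hamming_dist y z < d}"
  have "card (?S y) = card (?S y')"
  proof (rule edge_transitive_card_common[OF et])
    show "y \<noteq> 0" "y' \<noteq> 0" using y by (metis zero_index zero_neq_one)+
    show "hamming_dist 0 y < d" "hamming_dist 0 y' < d"
      unfolding h0 using y d by auto
  qed
  moreover have "card (?S y') < card (?S y)"
  proof -
    \<comment> \<open>The two sets differ only at \<open>K z = d - 2\<close>, where \<open>?S y'\<close> requires \<open>(z $ i, z $ j)\<close> to be
      \<open>(0, 1)\<close> or \<open>(1, 0)\<close>, while \<open>?S y\<close> only requires \<open>z $ j = 0\<close>.\<close>
    define F :: "'a ^ 'n \<Rightarrow> 'a ^ 'n" where "F z =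
      (if K z = d - 2 \<and> z $ i = 0 then \<chi> l. if l = j then 1 - z $ l else z $ l else z)" for z
    have KF: "K (F z) = K z" for z
      unfolding K_def by (rule arg_cong[where f = card]) (auto simp: F_def)
    have Fi: "F z $ i = z $ i" for z
      using ij by (auto simp: F_def)
    have Fj: "F z $ j = (if K z = d - 2 \<and> z $ i = 0 then 1 - z $ j else z $ j)" for z
      by (auto simp: F_def)
    \<comment> \<open>The third field element \<open>c\<close> yields a \<open>w\<close> at distance
      \<open>d - 1\<close> from both \<open>0\<close> and \<open>y\<close>, but at distance
      \<open>d\<close> from \<open>y'\<close>.\<close>
    have "d - 2 + card {i, j} \<le> CARD('n)"
      using ij d by simp
    then obtain w :: "'a ^ 'n" where "K w = d - 2"
      and "\<And>l. l \<in> {i, j} \<Longrightarrow> w $ l = (\<chi> l. if l = i then c else 0) $ l"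
      using ex_vec_weight_outside unfolding K_def by blast
    then have w: "K w = d - 2" "w $ i = c" "w $ j = 0"
      using ij by auto
    show ?thesis
    proof (rule card_less_if_involution[of F])
      fix z
      have "F (F z) $ l = z $ l" for l
      proof (cases "l = j")
        case True
        then show ?thesis by (simp add: Fj Fi KF)
      next
        case False
        then have "F z $ l = z $ l" for z by (simp add: F_def)
        then show ?thesis by simp
      qed
      then show "F (F z) = z" by (simp add: vec_eq_iff)
    next
      fix z assume "z \<in> ?S y'"
      then have z: "hamming_dist 0 z < d" "hamming_dist y' z < d" by auto
      consider "K z < d - 2" | "K z = d - 2" | "K z > d - 2" by linarith
      then have "hamming_dist 0 (F z) < d \<and> hamming_dist y (F z) < d"
      proof cases
        case 1
        then show ?thesis unfolding h0 hy KF Fi Fj by (auto simp: of_bool_def)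
      next
        \<comment> \<open>\<open>F\<close> sends the pattern (0, 1) to (0, 0) and fixes (1,
          0).\<close>
        case 2
        then show ?thesis using z d unfolding h0 hy hy' KF Fi Fj
          by (auto simp: of_bool_def split: if_splits)
      next
        \<comment> \<open>Impossible: both \<open>z $ i\<close> and \<open>z $ j\<close> would have
          to equal 0 and also 1.\<close>
        case 3
        then show ?thesis using z d unfolding h0 hy hy' KF Fi Fj
          by (auto simp: of_bool_def split: if_splits)
      qed
      then show "F z \<in> ?S y" by simp
    next
      show "w \<in> ?S y" using w c d by (auto simp: h0 hy)
      have "F w = w" using w c by (simp add: F_def)
      then show "F w \<notin> ?S y'" using w c d by (auto simp: hy')
    qed
  qed
  ultimately show False by simp
qed

text \<open>Over two elements, weights 1 and 2 give equally many common neighbours, so weight 1 is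
  compared with weight 3; \<open>3 < d\<close> makes the vector of weight 3 adjacent to
  \<open>0\<close>.\<close>

lemma not_edge_transitive_if_binary:
  assumes q: "CARD('a::{field,finite}) = 2" and d: "3 < d" "d < CARD('n)"
  shows "\<not> edge_transitive (gen_hamming_graph d :: ('a ^ 'n) ugraph)"
proof
  assume et: "edge_transitive (gen_hamming_graph d :: ('a ^ 'n) ugraph)"
  obtain T :: "'n set" where "card T = 3"
    using obtain_subset_with_card_n[of 3 "UNIV :: 'n set"] d by auto
  then obtain i j k :: 'n where ij: "i \<noteq> j" "i \<noteq> k" "j \<noteq> k"
    by (auto simp: card_3_iff)
  define y y' :: "'a ^ 'n" where "y = (\<chi> l. of_bool (l = i))"
    and "y' = (\<chi> l. of_bool (l \<in> {i, j, k}))"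
  define K where "K z = card {l. l \<notin> {i, j, k} \<and> z $ l \<noteq> 0}" for z :: "'a ^ 'n"
  have h0: "hamming_dist 0 z =
      K z + of_bool (z $ i \<noteq> 0) + of_bool (z $ j \<noteq> 0) + of_bool (z $ k \<noteq> 0)" for z
    using hamming_dist_supported[of "{i, j, k}" 0 z] ij by (auto simp: K_def)
  have hy: "hamming_dist y z =
      K z + of_bool (z $ i \<noteq> 1) + of_bool (z $ j \<noteq> 0) + of_bool (z $ k \<noteq> 0)" for z
    using hamming_dist_supported[of "{i, j, k}" y z] ij by (auto simp: K_def y_def)
  have hy': "hamming_dist y' z =
      K z + of_bool (z $ i \<noteq> 1) + of_bool (z $ j \<noteq> 1) + of_bool (z $ k \<noteq> 1)" for z
    using hamming_dist_supported[of "{i, j, k}" y' z] ij by (auto simp: K_def y'_def)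
  have y: "y $ i = 1" "y $ j = 0" "y $ k = 0" "y' $ i = 1" "y' $ j = 1" "y' $ k = 1"
      "K y = 0" "K y' = 0"
    using ij by (auto simp: y_def y'_def K_def)
  let ?S = "\<lambda>y. {z. hamming_dist 0 z < d \<and> hamming_dist y z < d}"
  have "card (?S y) = card (?S y')"
  proof (rule edge_transitive_card_common[OF et])
    show "y \<noteq> 0" "y' \<noteq> 0" using y by (metis zero_index zero_neq_one)+
    show "hamming_dist 0 y < d" "hamming_dist 0 y' < d"
      unfolding h0 using y d by auto
  qed
  moreover have "card (?S y') < card (?S y)"
  proof -
    \<comment> \<open>At \<open>K z = d - 3\<close>, \<open>?S y'\<close> excludes the patterns 000 and 111 on \<open>i, j, k\<close>, while \<open>?S y\<close>
      excludes 011 and 111; at \<open>K z = d - 2\<close> only \<open>?S y\<close> has elements.\<close>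
    define P where "P z \<longleftrightarrow> K z = d - 3 \<and> z $ i = 0 \<and> z $ j = z $ k" for z
    define F :: "'a ^ 'n \<Rightarrow> 'a ^ 'n" where "F z =
      (if P z then \<chi> l. if l \<in> {j, k} then 1 - z $ l else z $ l else z)" for z
    have KF: "K (F z) = K z" for z
      unfolding K_def by (rule arg_cong[where f = card]) (auto simp: F_def)
    have Fi: "F z $ i = z $ i" for z
      using ij by (auto simp: F_def)
    have Fj: "F z $ j = (if P z then 1 - z $ j else z $ j)"
      and Fk: "F z $ k = (if P z then 1 - z $ k else z $ k)" for z
      by (auto simp: F_def)
    have PF: "P (F z) \<longleftrightarrow> P z" for z
      unfolding P_def KF Fi Fj Fk by (auto simp: P_def)
    \<comment> \<open>Here \<open>d < CARD('n)\<close> enters. The resulting \<open>w\<close> has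
      distances \<open>d - 2\<close>, \<open>d - 1\<close> and \<open>d + 1\<close> from
      \<open>0\<close>, \<open>y\<close> and \<open>y'\<close>.\<close>
    have "d - 2 + card {i, j, k} \<le> CARD('n)"
      using ij d by simp
    then obtain w :: "'a ^ 'n" where "K w = d - 2"
      and "\<And>l. l \<in> {i, j, k} \<Longrightarrow> w $ l = 0 $ l"
      using ex_vec_weight_outside unfolding K_def by blast
    then have w: "K w = d - 2" "w $ i = 0" "w $ j = 0" "w $ k = 0"
      by auto
    show ?thesis
    proof (rule card_less_if_involution[of F])
      fix z
      have "F (F z) $ l = z $ l" for l
      proof (cases "l \<in> {j, k}")
        case True
        then show ?thesis by (auto simp: Fj Fk PF)
      next
        case False
        then have "F z $ l = z $ l" for z by (simp add: F_def)
        then show ?thesis by simp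
      qed
      then show "F (F z) = z" by (simp add: vec_eq_iff)
    next
      fix z assume "z \<in> ?S y'"
      then have z: "hamming_dist 0 z < d" "hamming_dist y' z < d" by auto
      have bits: "z $ i = 0 \<or> z $ i = 1" "z $ j = 0 \<or> z $ j = 1" "z $ k = 0 \<or> z $ k = 1"
        using two_element_field[OF q] by blast+
      consider "K z < d - 3" | "K z = d - 3" | "K z > d - 3" by linarith
      then have "hamming_dist 0 (F z) < d \<and> hamming_dist y (F z) < d"
      proof cases
        case 1
        then show ?thesis unfolding h0 hy KF Fi Fj Fk by (auto simp: of_bool_def)
      next
        \<comment> \<open>\<open>F\<close> exchanges the patterns 000 and 011, turning the one that
          \<open>?S y\<close> excludes into one that it admits.\<close>
        case 2
        then show ?thesis using z d bits unfolding h0 hy hy' KF Fi Fj Fk P_def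
          by (elim disjE) auto
      next
        \<comment> \<open>Impossible: the distances of \<open>z\<close> from \<open>0\<close> and
          \<open>y'\<close> add up to \<open>2 * K z + 3\<close>, which is at least
          \<open>2 * d - 1\<close>.\<close>
        case 3
        then show ?thesis using z d bits unfolding h0 hy'
          by (elim disjE) auto
      qed
      then show "F z \<in> ?S y" by simp
    next
      show "w \<in> ?S y" using w d by (auto simp: h0 hy)
      have "d - 2 \<noteq> d - 3" using d by simp
      then have "F w = w" using w(1) by (simp add: F_def P_def)
      then show "F w \<notin> ?S y'" using w d by (auto simp: hy')
    qed
  qed
  ultimately show False by simp
qed

section \<open>Assembling the equivalence\<close>

lemma edge_transitive_if_distance_transitive:
  fixes G :: "('a::{field,finite} ^ 'n) ugraph"
  assumes G: "G = gen_hamming_graph d" and "2 \<le> d" and "distance_transitive G"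
  shows "edge_transitive G"
  unfolding edge_transitive_def
proof (intro ballI)
  fix e1 e2 assume "e1 \<in> edges G" "e2 \<in> edges G"
  then obtain v1 v2 u1 u2 where e: "e1 = {v1, v2}" "e2 = {u1, u2}"
    and "v1 \<noteq> v2" "hamming_dist v1 v2 < d" "u1 \<noteq> u2" "hamming_dist u1 u2 < d"
    unfolding G gen_hamming_graph_def by auto
  then have "graph_dist G v1 v2 = graph_dist G u1 u2"
    by (simp add: G graph_dist_eq_1[OF \<open>2 \<le> d\<close>])
  then have "\<exists>f. automorphism G f \<and> f v1 = u1 \<and> f v2 = u2"
    using assms(3) unfolding distance_transitive_def by (simp add: G)
  then obtain f where "automorphism G f" "f v1 = u1" "f v2 = u2"
    by blast
  then show "\<exists>f. automorphism G f \<and> f ` e1 = e2"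
    unfolding e by (intro exI[of _ f]) auto
qed

theorem theorem4p1p1:
  fixes q n d :: nat and G :: "('a::{field,finite} ^ 'n) ugraph"
  assumes "q = CARD('a)" and "n = CARD('n)"
    and "2 \<le> d" and "d \<le> n"
    and "G = gen_hamming_graph d"
  shows "(edge_transitive G \<longleftrightarrow> distance_transitive G) \<and>
         (distance_transitive G \<longleftrightarrow> d = 2 \<or> (q, d) = (2, 3) \<or> (q, d) = (2, n))"
proof -
  let ?P = "d = 2 \<or> (q, d) = (2, 3) \<or> (q, d) = (2, n)"
  have "distance_transitive G" if ?P
    using that assms distance_transitive_if_distance_2 distance_transitive_if_binary_distance_3
      distance_transitive_if_binary_distance_card by auto
  moreover have "edge_transitive G" if "distance_transitive G"
    using edge_transitive_if_distance_transitive assms that by blast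
  moreover have ?P if et: "edge_transitive G"
  proof (rule ccontr)
    assume nP: "\<not> ?P"
    have "card {0, 1 :: 'a} \<le> CARD('a)" by (rule card_mono) auto
    then have "q = 2 \<or> 3 \<le> q" using assms(1) by auto
    then show False
    proof
      \<comment> \<open>The negated condition leaves exactly \<open>3 < d\<close> and
        \<open>d < n\<close>.\<close>
      assume "q = 2"
      then show False
        using not_edge_transitive_if_binary[where 'a = 'a and 'n = 'n and d = d] et nP assms by auto
    next
      assume "3 \<le> q"
      then show False
        using not_edge_transitive_if_card_ge_3[where 'a = 'a and 'n = 'n and d = d] et nP assms
        by auto
    qed
  qed
  ultimately show ?thesis by blast
qed

end
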